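(* Let $n\ge1$ and let $\mathcal{C}$ be the binary $[2^n-1,n]$ simplex code. Then $\mathcal{C}$ is a functional $(s,2^{n-1})$-batch code for every integer $s$ with $1\le s\le\min\{4,2^{n-1}\}$.
   Context: The binary $[2^n-1,n]$ simplex code is the binary linear code whose $n\times(2^n-1)$ generator matrix $\mathbf{G}=[\mathbf{g}_1,\dots,\mathbf{g}_{2^n-1}]$ has as columns all nonzero vectors of $\mathbb{F}_2^n$ (each exactly once). A binary linear code with generator matrix $\mathbf{G}=[\mathbf{g}_1,\dots,\mathbf{g}_N]\in\mathbb{F}_2^{n\times N}$ with nonzero columns is a functional $(s,t)$-batch code ($1\le s\le t$) if for every multiset of request vectors $I=\{\mathbf{v}_1^{(a_1)},\dots,\mathbf{v}_s^{(a_s)}\}$, i.e. nonzero vectors $\mathbf{v}_1,\dots,\mathbf{v}_s\in\mathbb{F}_2^n$ (not necessarily distinct) with multiplicities $a_i\ge1$ and $\sum_i a_i=t$, there exist $t$ pairwise disjoint sets $R_{i,j}\subseteq[N]$ ($i\in[s]$, $j\in[a_i]$) with $\sum_{l\in R_{i,j}}\mathbf{g}_l=\mathbf{v}_i$ for all $i,j$. *)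

theory Defs
  imports Main "HOL-Library.Z2"
begin

definition F2vec :: "nat \<Rightarrow> (nat \<Rightarrow> bit) set" where
  "F2vec n = {v. \<forall>i\<ge>n. v i = 0}"

text \<open>Generator matrix with columns g 0, ..., g (N-1), all in F_2^n.
  The simplex code: the columns enumerate all nonzero vectors of F_2^n, each exactly once.\<close>
definition simplex_generator :: "nat \<Rightarrow> (nat \<Rightarrow> nat \<Rightarrow> bit) \<Rightarrow> bool" where
  "simplex_generator n g \<longleftrightarrow> bij_betw g {..<2^n - 1} (F2vec n - {\<lambda>_. 0})"

text \<open>Functional (s,t)-batch code for the code generated by columns g 0..g (N-1).
  Requests: v 0..v (s-1) nonzero in F_2^n (not necessarily distinct) with multiplicities
  a i >= 1 summing to t; recovery sets R i j (i<s, j<a i) pairwise disjoint subsets of [N].\<close>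
definition functional_batch_code ::
    "nat \<Rightarrow> nat \<Rightarrow> (nat \<Rightarrow> nat \<Rightarrow> bit) \<Rightarrow> nat \<Rightarrow> nat \<Rightarrow> bool" where
  "functional_batch_code n N g s t \<longleftrightarrow>
     (\<forall>v a. (\<forall>i<s. v i \<in> F2vec n - {\<lambda>_. 0}) \<and> (\<forall>i<s. 1 \<le> a i) \<and> (\<Sum>i<s. a i) = t \<longrightarrow>
        (\<exists>R :: nat \<Rightarrow> nat \<Rightarrow> nat set.
           (\<forall>i<s. \<forall>j<a i. R i j \<subseteq> {..<N} \<and> (\<lambda>k. \<Sum>l\<in>R i j. g l k) = v i) \<and>
           (\<forall>i<s. \<forall>j<a i. \<forall>i'<s. \<forall>j'<a i'. (i, j) \<noteq> (i', j') \<longrightarrow> R i j \<inter> R i' j' = {})))"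

end

theory Submission
  imports Defs "HOL-Library.Multiset" "HOL-Library.Disjoint_Sets" "HOL-Library.Function_Algebras"
begin

text \<open>
  A request for \<open>v\<close> is served by a pair \<open>{x, x + v}\<close> or by the single column \<open>v\<close>; adding the
  zero vector as a fictitious column turns the latter into the pair \<open>{0, v}\<close>. Let \<open>U\<close> be the span
  of the requested vectors. A coset of \<open>U\<close> can be partitioned into pairs with any prescribed
  differences that all have even multiplicity; when four independent vectors occur twice each,
  this is a perfect matching of the 4-cube with two edges in every direction. Only the subgroup
  \<open>U\<close> itself (or a smaller one containing the requests that remain) has to absorb the odd
  multiplicities. Their number is 0, 2 or 4, and serving each of the odd vectors by a
  single column leaves enough slack in \<open>U\<close>, by explicit partitions for dimensions 2, 3 and 4.
\<close>

section \<open>Abelian groups of exponent two\<close>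

class boolean_group = ab_group_add +
  assumes add_self [simp]: "x + x = 0"
begin

lemma add_self_left [simp]: "x + (x + y) = y"
  by (simp add: add.assoc [symmetric])

lemma add_eq_0_iff_eq: "x + y = 0 \<longleftrightarrow> x = y"
  by (metis add_0_right add_self_left add_self)

end

instance bit :: boolean_group
  by standard simp

text \<open>Turns the vectors \<open>nat \<Rightarrow> bit\<close> of the code, with pointwise
  addition, into a boolean group, so that the combinatorics can be done abstractly.\<close>

instance "fun" :: (type, boolean_group) boolean_group
  by standard (simp add: fun_eq_iff)

section \<open>Serving a multiset of requests by disjoint sets of columns\<close>

inductive serves :: "'a::comm_monoid_add set \<Rightarrow> 'a multiset \<Rightarrow> bool" where
  empty: "serves W {#}"
| add: "serves W M \<Longrightarrow> finite R \<Longrightarrow> R \<inter> W = {} \<Longrightarrow> W \<union> R \<subseteq> W' \<Longrightarrow> serves W' (add_mset (\<Sum>R) M)"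

lemma serves_mono: "serves W M \<Longrightarrow> W \<subseteq> W' \<Longrightarrow> serves W' M"
proof (induction rule: serves.induct)
  case (add W M R W'')
  show ?case
    by (rule serves.add[OF add.hyps(1-3)]) (use add in blast)
qed (rule serves.empty)

lemma serves_union:
  "serves A M \<Longrightarrow> serves B N \<Longrightarrow> A \<inter> B = {} \<Longrightarrow> serves (A \<union> B) (M + N)"
proof (induction rule: serves.induct)
  case (empty W)
  then show ?case by (auto intro: serves_mono)
next
  case (add W M R W')
  then have "serves (W \<union> B) (M + N)" by blast
  with add show ?case
    by (auto intro!: serves.add[of "W \<union> B" "M + N" R])
qed

text \<open>Allows the zero vector to be treated as a column throughout.\<close>

lemma serves_remove_zero: "serves W M \<Longrightarrow> serves (W - {0}) M"
proof (induction rule: serves.induct)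
  case (add W M R W')
  have "\<Sum>R = \<Sum>(R - {0})"
    using add by (simp add: sum.mono_neutral_right)
  with add show ?case
    by (auto intro!: serves.add[of "W - {0}" M "R - {0}"])
qed (rule serves.empty)

text \<open>Equal requests are interchangeable, so the recovery set added last can go to any index
  \<open>j\<close> with the right value. This recovers an indexed family from the multiset
  formulation.\<close>

lemma serves_obtains_family:
  assumes "serves W M" "finite J" "image_mset f (mset_set J) = M"
  shows "\<exists>R. (\<forall>j\<in>J. R j \<subseteq> W \<and> \<Sum>(R j) = f j) \<and> disjoint_family_on R J"
  using assms
proof (induction arbitrary: J rule: serves.induct)
  case (empty W)
  then have "J = {}" by (auto simp: mset_set_empty_iff)
  then show ?case by (simp add: disjoint_family_on_def)
next
  case (add W M R W')
  have "\<Sum>R \<in># image_mset f (mset_set J)" using add.prems by simp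
  then obtain j where j: "j \<in> J" "f j = \<Sum>R"
    using add.prems(1) by auto
  have "mset_set J = add_mset j (mset_set (J - {j}))"
    using j add.prems by (simp add: mset_set.remove)
  then have "image_mset f (mset_set (J - {j})) = M"
    using add.prems j by simp
  then obtain S where S: "\<forall>i\<in>J - {j}. S i \<subseteq> W \<and> \<Sum>(S i) = f i" "disjoint_family_on S (J - {j})"
    using add.IH add.prems by (metis finite_Diff)
  show ?case
  proof (intro exI conjI)
    show "\<forall>i\<in>J. (S(j := R)) i \<subseteq> W' \<and> \<Sum>((S(j := R)) i) = f i"
      using S j add.hyps by auto
    show "disjoint_family_on (S(j := R)) J"
      using S add.hyps by (fastforce simp: disjoint_family_on_def)
  qed
qed

text \<open>Each inner list is one recovery set. For explicit partitions, all disjointness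
  conditions become a single \<open>distinct\<close> condition that simplification can
  settle.\<close>

lemma serves_lists:
  "distinct (concat xss) \<Longrightarrow> serves (set (concat xss)) (mset (map sum_list xss))"
proof (induction xss)
  case (Cons xs xss)
  then have "serves (set (concat xss)) (mset (map sum_list xss))" "distinct xs"
    "set xs \<inter> set (concat xss) = {}" by auto
  moreover from this have "sum_list xs = \<Sum>(set xs)"
    by (metis distinct_sum_list_conv_Sum)
  ultimately show ?case
    by (auto intro!: serves.add[of "set (concat xss)"])
qed (simp add: serves.empty)

lemma serves_listsI:
  assumes "distinct (concat xss)" "set (concat xss) \<subseteq> W" "mset (map sum_list xss) = M"
  shows "serves W M"
  using serves_mono[OF serves_lists[OF assms(1)] assms(2)] assms(3) by simp

text \<open>Translating both members of a pair by \<open>x\<close> keeps their sum, because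
  \<open>x + x = 0\<close>; a matching of a subgroup thus carries over to its cosets.\<close>

lemma serves_translate_pairs:
  fixes x :: "'a::boolean_group"
  assumes "distinct (concat (map (\<lambda>(u, w). [u, w]) ps))"
  shows "serves ((+) x ` set (concat (map (\<lambda>(u, w). [u, w]) ps))) (mset (map (\<lambda>(u, w). u + w) ps))"
proof -
  let ?xss = "map (map ((+) x)) (map (\<lambda>(u, w). [u, w]) ps)"
  have "distinct (concat ?xss)"
    using assms by (simp only: map_concat[symmetric] distinct_map) simp
  moreover have "set (concat ?xss) = (+) x ` set (concat (map (\<lambda>(u, w). [u, w]) ps))"
    by (simp only: map_concat[symmetric] set_map)
  moreover have "map sum_list ?xss = map (\<lambda>(u, w). u + w) ps"
    by (auto simp: ac_simps)
  ultimately show ?thesis using serves_lists[of ?xss] by metis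
qed

section \<open>Spans, independence and cosets\<close>

text \<open>In a boolean group the set of this list is the span over the two-element field, and
  \<open>distinct\<close> says that \<open>vs\<close> is linearly independent.\<close>

fun subset_sums :: "'a::ab_group_add list \<Rightarrow> 'a list" where
  "subset_sums [] = [0]"
| "subset_sums (v # vs) = subset_sums vs @ map ((+) v) (subset_sums vs)"

text \<open>The steps that adjoin two vectors commute, so the multiset of sums is a fold over
  \<open>mset xs\<close>. This allows basis vectors to be reordered.\<close>

lemma mset_subset_sums_perm:
  assumes "mset xs = mset ys"
  shows "mset (subset_sums xs) = mset (subset_sums ys)"
proof -
  let ?f = "\<lambda>v X. X + image_mset ((+) v) X"
  interpret comp_fun_commute "?f :: 'a \<Rightarrow> 'a multiset \<Rightarrow> 'a multiset"
    by standard (auto simp: fun_eq_iff multiset.map_comp comp_def ac_simps)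
  have "mset (subset_sums zs) = fold_mset ?f {#0#} (mset zs)" for zs :: "'a list"
    by (induction zs) auto
  then show ?thesis using assms by simp
qed

lemma distinct_subset_sums_perm:
  "mset xs = mset ys \<Longrightarrow> distinct (subset_sums xs) \<longleftrightarrow> distinct (subset_sums ys)"
  by (rule mset_eq_imp_distinct_iff, rule mset_subset_sums_perm)

lemma set_subset_sums_perm:
  "mset xs = mset ys \<Longrightarrow> set (subset_sums xs) = set (subset_sums ys)"
  by (rule mset_eq_setD, rule mset_subset_sums_perm)

text \<open>In a boolean group these are exactly the subgroups, as every element is its own
  negative.\<close>

definition additively_closed :: "'a::ab_group_add set \<Rightarrow> bool" where
  "additively_closed U \<longleftrightarrow> 0 \<in> U \<and> (\<forall>x\<in>U. \<forall>y\<in>U. x + y \<in> U)"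

text \<open>For a subgroup \<open>U\<close> this means that \<open>W\<close> is a union of cosets of
  \<open>U\<close>.\<close>

definition stable_under :: "'a::ab_group_add set \<Rightarrow> 'a set \<Rightarrow> bool" where
  "stable_under U W \<longleftrightarrow> (\<forall>w\<in>W. \<forall>u\<in>U. w + u \<in> W)"

lemma length_subset_sums: "length (subset_sums vs) = 2 ^ length vs"
  by (induction vs) auto

lemma card_subset_sums: "distinct (subset_sums vs) \<Longrightarrow> card (set (subset_sums vs)) = 2 ^ length vs"
  by (simp add: distinct_card length_subset_sums)

lemma additively_closed_subset_sums:
  "additively_closed (set (subset_sums (vs :: 'a::boolean_group list)))"
proof (induction vs)
  case (Cons v vs)
  then show ?case
    by (auto simp: additively_closed_def image_iff ac_simps)
qed (simp add: additively_closed_def)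

lemma subset_sums_subset:
  assumes "additively_closed U" "set vs \<subseteq> U"
  shows "set (subset_sums vs) \<subseteq> U"
  using assms by (induction vs) (auto simp: additively_closed_def)

lemma distinct_subset_sums_Cons:
  fixes v :: "'a::boolean_group"
  assumes "distinct (subset_sums vs)" "v \<notin> set (subset_sums vs)"
  shows "distinct (subset_sums (v # vs))"
proof -
  have "v + x \<notin> set (subset_sums vs)" if "x \<in> set (subset_sums vs)" for x
  proof
    assume "v + x \<in> set (subset_sums vs)"
    then have "(v + x) + x \<in> set (subset_sums vs)"
      using that additively_closed_subset_sums[of vs] unfolding additively_closed_def by blast
    with assms show False by (simp add: add.assoc)
  qed
  with assms show ?thesis by (auto simp: distinct_map)
qed

text \<open>Translation by \<open>u\<close> is an involution: a point moved into \<open>X\<close>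
  would have come from \<open>X\<close>.\<close>

lemma stable_under_Diff:
  fixes U :: "'a::boolean_group set"
  assumes "stable_under U W" "stable_under U X"
  shows "stable_under U (W - X)"
proof -
  have "w + u \<notin> X" if "w \<in> W - X" "u \<in> U" for w u
  proof
    assume "w + u \<in> X"
    then have "(w + u) + u \<in> X" using assms that unfolding stable_under_def by blast
    then show False using that by (simp add: add.assoc)
  qed
  with assms show ?thesis by (auto simp: stable_under_def)
qed

lemma stable_under_subset: "stable_under U W \<Longrightarrow> U' \<subseteq> U \<Longrightarrow> stable_under U' W"
  by (auto simp: stable_under_def)

lemma stable_under_coset: "additively_closed U \<Longrightarrow> stable_under U ((+) x ` U)"
  by (auto simp: stable_under_def additively_closed_def add.assoc)

lemma stable_under_self: "additively_closed U \<Longrightarrow> stable_under U U"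
  by (auto simp: stable_under_def additively_closed_def)

lemma coset_subset: "stable_under U W \<Longrightarrow> x \<in> W \<Longrightarrow> (+) x ` U \<subseteq> W"
  by (auto simp: stable_under_def)

lemma card_coset: "card ((+) (x::'a::ab_group_add) ` U) = card U"
  by (simp add: card_image)

section \<open>Perfect pairings for even multiplicities\<close>

text \<open>Stability under \<open>v\<close> splits \<open>W\<close> into pairs
  \<open>{x, x + v}\<close>, which are removed one by one.\<close>

lemma serves_single_vector:
  fixes v :: "'a::boolean_group"
  assumes "finite W" "stable_under {v} W" "v \<noteq> 0" "card W = 2 * m"
  shows "serves W (replicate_mset m v)"
  using assms
proof (induction m arbitrary: W)
  case (Suc m)
  then obtain x where x: "x \<in> W" by fastforce
  define W' where "W' = W - {x, x + v}"
  have xv: "x + v \<in> W" "x \<noteq> x + v" using Suc x by (auto simp: stable_under_def)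
  have "stable_under {v} {x, x + v}" by (auto simp: stable_under_def add.assoc)
  then have "stable_under {v} W'"
    unfolding W'_def using Suc by (intro stable_under_Diff)
  moreover have "card W' = 2 * m"
    unfolding W'_def using Suc x xv by (subst card_Diff_subset) auto
  ultimately have "serves W' (replicate_mset m v)"
    using Suc unfolding W'_def by blast
  moreover have "\<Sum>{x, x + v} = v" using xv by simp
  ultimately show ?case
    using serves.add[of W' "replicate_mset m v" "{x, x + v}" W] x xv
    by (auto simp: W'_def)
qed (simp add: serves.empty)

lemma multiset_split_size:
  fixes N :: "'a multiset"
  assumes "m \<le> size N"
  obtains A B where "N = A + B" "size A = m"
proof -
  obtain xs where "mset xs = N" using ex_mset by blast
  with assms that[of "mset (take m xs)" "mset (drop m xs)"] show thesis
    by (auto simp flip: mset_append)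
qed

text \<open>Cosets of \<open>U\<close> are peeled off \<open>W\<close>, each taking \<open>m\<close>
  vectors of \<open>N\<close> twice, that is \<open>2 * m\<close> pairs. Hence only batches of size
  \<open>m\<close> on a single coset need treatment.\<close>

lemma serves_cosets:
  fixes U :: "'a::boolean_group set"
  assumes U: "additively_closed U" "card U = 4 * m" "m > 0"
    and coset: "\<And>x N. set_mset N \<subseteq> G \<Longrightarrow> size N = m \<Longrightarrow> serves ((+) x ` U) (N + N)"
    and "finite W" "stable_under U W" "card W = 4 * size N" "set_mset N \<subseteq> G"
  shows "serves W (N + N)"
  using assms(5-)
proof (induction "size N" arbitrary: N W rule: less_induct)
  case less
  show ?case
  proof (cases "W = {}")
    case True
    then show ?thesis using less by (simp add: serves.empty)
  next
    case False
    then obtain x where x: "x \<in> W" by blast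
    have sub: "(+) x ` U \<subseteq> W" using less x by (intro coset_subset)
    then have "4 * m \<le> 4 * size N"
      using card_mono[OF less.prems(1) sub] less.prems U by (simp add: card_coset)
    then have "m \<le> size N" by simp
    then obtain A B where N: "N = A + B" "size A = m"
      by (rule multiset_split_size)
    have A: "serves ((+) x ` U) (A + A)" using less.prems N by (intro coset) auto
    have B: "serves (W - (+) x ` U) (B + B)"
    proof (rule less.hyps)
      show "card (W - (+) x ` U) = 4 * size B"
        using less.prems sub N U by (subst card_Diff_subset) (auto simp: card_coset intro: finite_subset)
      show "stable_under U (W - (+) x ` U)"
        using less.prems U by (intro stable_under_Diff stable_under_coset)
    qed (use less.prems N U in auto)
    have "serves ((+) x ` U \<union> (W - (+) x ` U)) ((A + A) + (B + B))"
      by (rule serves_union[OF A B]) auto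
    moreover have "(+) x ` U \<union> (W - (+) x ` U) = W" using sub by blast
    ultimately show ?thesis by (simp add: N ac_simps)
  qed
qed


text \<open>\<open>G\<close> holds the permitted differences. The cardinality condition leaves
  exactly two columns for each of the \<open>2 * size N\<close> requests.\<close>

definition evenly_served :: "'a::boolean_group set \<Rightarrow> 'a set \<Rightarrow> bool" where
  "evenly_served U G \<longleftrightarrow> (\<forall>W N. finite W \<longrightarrow> stable_under U W \<longrightarrow> card W = 4 * size N \<longrightarrow>
     set_mset N \<subseteq> G \<longrightarrow> serves W (N + N))"

lemma evenly_served_4:
  assumes "additively_closed U" "card U = 4"
  shows "evenly_served U (U - {0})"
  unfolding evenly_served_def
proof (intro allI impI, rule serves_cosets[OF assms(1), of 1])
  fix x and N :: "'a multiset"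
  assume N: "set_mset N \<subseteq> U - {0}" "size N = 1"
  then obtain v where v: "N = {#v#}" using size_1_singleton_mset by blast
  have "serves ((+) x ` U) (replicate_mset 2 v)"
  proof (rule serves_single_vector)
    show "stable_under {v} ((+) x ` U)"
      using stable_under_coset[OF assms(1)] N v by (auto intro: stable_under_subset)
    show "finite ((+) x ` U)" using assms by (metis card.infinite finite_imageI zero_neq_numeral)
  qed (use N v assms in \<open>auto simp: card_coset\<close>)
  then show "serves ((+) x ` U) (N + N)" by (simp add: v numeral_2_eq_2)
qed (use assms in auto)

text \<open>Here a batch consists of two vectors \<open>v\<close> and \<open>w\<close>. If they
  differ, the coset splits into two cosets of their span, one paired along \<open>v\<close> and the
  other along \<open>w\<close>.\<close>

lemma evenly_served_8:
  assumes U: "additively_closed U" "card U = 8"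
  shows "evenly_served U (U - {0})"
  unfolding evenly_served_def
proof (intro allI impI, rule serves_cosets[OF assms(1), of 2])
  fix x and N :: "'a multiset"
  assume N: "set_mset N \<subseteq> U - {0}" "size N = 2"
  then obtain v N' where "N = add_mset v N'" "size N' = 1"
    by (metis One_nat_def Suc_1 size_add_mset size_eq_Suc_imp_eq_union nat.inject)
  then obtain w where vw: "N = {#v, w#}" using size_1_singleton_mset by blast
  define X where "X = (+) x ` U"
  have finX: "finite X" unfolding X_def using assms by (metis card.infinite finite_imageI zero_neq_numeral)
  have stX: "stable_under U X" unfolding X_def using U by (intro stable_under_coset)
  have cardX: "card X = 8" by (simp add: X_def card_coset U)
  show "serves ((+) x ` U) (N + N)"
  proof (cases "v = w")
    case True
    have "serves X (replicate_mset 4 v)"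
      using N vw finX stX cardX
      by (intro serves_single_vector) (auto intro: stable_under_subset)
    then show ?thesis using True by (simp add: X_def vw numeral_eq_Suc)
  next
    case False
    define F where "F = set (subset_sums [v, w])"
    define Y where "Y = (+) x ` F"
    have "distinct (subset_sums [v, w])" using False N vw by (auto simp: add_eq_0_iff_eq)
    then have cardY: "card Y = 4"
      unfolding Y_def F_def card_coset by (subst card_subset_sums) auto
    have FU: "F \<subseteq> U" unfolding F_def using N vw U by (intro subset_sums_subset) auto
    then have YX: "Y \<subseteq> X" by (auto simp: Y_def X_def)
    then have "finite Y" using finX finite_subset by blast
    then have "card (X - Y) = 4" using YX cardX cardY by (simp add: card_Diff_subset)
    have stY: "stable_under F Y" unfolding Y_def F_def
      by (intro stable_under_coset additively_closed_subset_sums)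
    have vwF: "v \<in> F" "w \<in> F" by (auto simp: F_def)
    have stXY: "stable_under F (X - Y)"
      using stX FU stY by (intro stable_under_Diff) (auto intro: stable_under_subset)
    have "serves Y (replicate_mset 2 v)"
      using N vw finX YX stY vwF cardY
      by (intro serves_single_vector) (auto intro: stable_under_subset finite_subset)
    moreover have "serves (X - Y) (replicate_mset 2 w)"
      using N vw finX stXY vwF \<open>card (X - Y) = 4\<close>
      by (intro serves_single_vector) (auto intro: stable_under_subset)
    ultimately have "serves (Y \<union> (X - Y)) (replicate_mset 2 v + replicate_mset 2 w)"
      by (intro serves_union) auto
    moreover have "Y \<union> (X - Y) = X" using YX by blast
    ultimately show ?thesis by (simp add: X_def vw numeral_2_eq_2 ac_simps add_mset_commute)
  qed
qed (use assms in auto)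

lemma obtain_perm_4:
  assumes "e \<in> {a, b, c, d}"
  obtains x y z where "mset [a, b, c, d] = mset [e, x, y, z]"
proof -
  have "mset [a, b, c, d] = mset [b, a, c, d]" "mset [a, b, c, d] = mset [c, a, b, d]"
    "mset [a, b, c, d] = mset [d, a, b, c]" by (simp_all add: ac_simps)
  with assms that show thesis by blast
qed

text \<open>A batch of four basis vectors either uses each once, which is settled by an explicit
  matching, or misses one; then the other three span a subgroup of order 8 that serves the
  batch.\<close>

lemma evenly_served_16:
  assumes dist: "distinct (subset_sums [a, b, c, d])"
  shows "evenly_served (set (subset_sums [a, b, c, d])) {a, b, c, d}"
  unfolding evenly_served_def
proof (intro allI impI, rule serves_cosets[OF additively_closed_subset_sums, of _ 4])
  fix x and N :: "'a multiset"
  assume N: "set_mset N \<subseteq> {a, b, c, d}" "size N = 4"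
  let ?X = "(+) x ` set (subset_sums [a, b, c, d])"
  show "serves ?X (N + N)"
  proof (cases "{a, b, c, d} \<subseteq> set_mset N")
    case True
    have "distinct [a, b, c, d]" using dist by auto
    then have "mset_set {a, b, c, d} = {#a, b, c, d#}" by simp
    moreover have "mset_set {a, b, c, d} \<subseteq># N"
      using mset_set_set_mset_msubset[of N] True N by (metis subset_antisym)
    ultimately have "{#a, b, c, d#} \<subseteq># N" by simp
    then have N_eq: "N = {#a, b, c, d#}"
      using N by (auto simp: subset_mset.le_iff_add)
    \<comment> \<open>a perfect matching of the 4-cube with two edges in each direction\<close>
    let ?ps = "[(0, a), (b, a+b), (c, b+c), (a+c, a+(c+d)), (a+(b+c), a+(b+(c+d))),
      (d, c+d), (a+d, a+(b+d)), (b+d, b+(c+d))]"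
    let ?Y = "set (concat (map (\<lambda>(u, w). [u, w]) ?ps))"
    have "serves ((+) x ` ?Y) (mset (map (\<lambda>(u, w). u + w) ?ps))"
      by (rule serves_translate_pairs) (use dist in \<open>simp add: ac_simps\<close>, elim conjE, simp)
    moreover have "(+) x ` ?Y \<subseteq> ?X" by (rule image_mono) simp
    ultimately have "serves ?X (mset (map (\<lambda>(u, w). u + w) ?ps))" by (rule serves_mono)
    moreover have "mset (map (\<lambda>(u, w). u + w) ?ps) = N + N"
      by (simp add: N_eq ac_simps add_mset_commute)
    ultimately show ?thesis by (simp only:)
  next
    case False
    then obtain e where e: "e \<in> {a, b, c, d}" "e \<notin># N" by blast
    obtain y z w where perm: "mset [a, b, c, d] = mset [e, y, z, w]"
      using obtain_perm_4[OF e(1)] .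
    let ?H = "set (subset_sums [y, z, w])"
    have "distinct (subset_sums [e, y, z, w])"
      using dist distinct_subset_sums_perm[OF perm] by blast
    then have disH: "distinct (subset_sums [y, z, w])" by (simp only: subset_sums.simps(2)[of e] distinct_append)
    have "set_mset N \<subseteq> {y, z, w}" using e N mset_eq_setD[OF perm] by auto
    moreover have "{y, z, w} \<subseteq> ?H - {0}" using disH by auto
    ultimately have "set_mset N \<subseteq> ?H - {0}" by blast
    moreover have "evenly_served ?H (?H - {0})"
      using card_subset_sums[OF disH] by (intro evenly_served_8 additively_closed_subset_sums) simp
    moreover have "stable_under ?H ?X"
    proof (rule stable_under_subset[OF stable_under_coset[OF additively_closed_subset_sums]])
      show "?H \<subseteq> set (subset_sums [a, b, c, d])"
        unfolding set_subset_sums_perm[OF perm] by auto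
    qed
    moreover have "card ?X = 4 * size N"
      unfolding card_coset card_subset_sums[OF dist] using N by simp
    ultimately show ?thesis unfolding evenly_served_def by blast
  qed
qed (use card_subset_sums[OF dist] in auto)

section \<open>Combining a core subgroup with its remaining cosets\<close>

text \<open>\<open>V - U\<close> is a union of cosets of \<open>U\<close>, so it takes the even part
  while \<open>U\<close> absorbs the irregular part \<open>A\<close>.\<close>

lemma serves_extend:
  assumes "evenly_served U G" "additively_closed U" "additively_closed V" "finite V" "U \<subseteq> V"
    and "serves U A" "card V = card U + 4 * size N" "set_mset N \<subseteq> G"
  shows "serves V (A + (N + N))"
proof -
  have "finite U" using assms(4,5) finite_subset by blast
  have "stable_under U (V - U)"
    using assms by (intro stable_under_Diff stable_under_self) (auto intro: stable_under_subset stable_under_self)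
  moreover have "card (V - U) = 4 * size N" using assms \<open>finite U\<close> by (simp add: card_Diff_subset)
  ultimately have "serves (V - U) (N + N)"
    using assms unfolding evenly_served_def by blast
  then have "serves (U \<union> (V - U)) (A + (N + N))"
    using assms(6) by (intro serves_union) auto
  moreover have "U \<union> (V - U) = V" using assms by blast
  ultimately show ?thesis by simp
qed

text \<open>\<open>P\<close> collects the elements of odd multiplicity.\<close>

lemma multiset_parity_split:
  "\<exists>P N. M = mset_set P + (N + N) \<and> finite P \<and> P \<subseteq> set_mset M"
proof (induction M)
  case (add x M)
  then obtain P N where *: "M = mset_set P + (N + N)" "finite P" "P \<subseteq> set_mset M" by blast
  show ?case
  proof (cases "x \<in> P")
    case True
    then have "mset_set P = add_mset x (mset_set (P - {x}))"
      using * by (simp add: mset_set.remove)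
    then have "add_mset x M = mset_set (P - {x}) + (add_mset x N + add_mset x N)"
      using * by simp
    with * show ?thesis by (metis Diff_subset finite_Diff set_mset_add_mset_insert subset_insertI2 subset_trans)
  next
    case False
    then have "add_mset x M = mset_set (insert x P) + (N + N)" using * by simp
    with * show ?thesis
      by (metis finite_insert insert_mono set_mset_add_mset_insert)
  qed
qed (auto intro: exI[of _ "{}"])


section \<open>Explicit partitions in dimension four\<close>

context
  fixes a b c d :: "'a::boolean_group"
  assumes dist: "distinct (subset_sums [a, b, c, d])"
begin

lemma serves_16_aaaa:
  "serves (set (subset_sums [a, b, c, d])) ({#a, b, c, d#} + {#a, a, a, a#})"
proof -
  let ?xss = "[[a], [b], [c], [d], [b+c, a+(b+c)], [b+d, a+(b+d)], [c+d, a+(c+d)],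
    [b+(c+d), a+(b+(c+d))]]"
  show ?thesis
  proof (rule serves_listsI[of ?xss])
    show "distinct (concat ?xss)"
      using dist by (simp add: ac_simps) (elim conjE, simp)
  qed (simp_all add: ac_simps add_mset_commute)
qed

lemma serves_16_aabb:
  "serves (set (subset_sums [a, b, c, d])) ({#a, b, c, d#} + {#a, a, b, b#})"
proof -
  let ?xss = "[[a], [b], [c], [d], [b+c, a+(b+c)], [b+d, a+(b+d)], [c+d, b+(c+d)],
    [a+(c+d), a+(b+(c+d))]]"
  show ?thesis
  proof (rule serves_listsI[of ?xss])
    show "distinct (concat ?xss)"
      using dist by (simp add: ac_simps) (elim conjE, simp)
  qed (simp_all add: ac_simps add_mset_commute)
qed

lemma serves_16_cccd:
  "serves (set (subset_sums [a, b, c, d])) ({#a, b, c, d#} + {#c, c, c, d#})"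
proof -
  let ?xss = "[[a], [b], [c], [d], [a+c, a+(c+d)], [a+b, a+(b+c)], [b+d, b+(c+d)],
    [a+(b+d), a+(b+(c+d))]]"
  show ?thesis
  proof (rule serves_listsI[of ?xss])
    show "distinct (concat ?xss)"
      using dist by (simp add: ac_simps) (elim conjE, simp)
  qed (simp_all add: ac_simps add_mset_commute)
qed

lemma serves_16_aacd:
  "serves (set (subset_sums [a, b, c, d])) ({#a, b, c, d#} + {#a, a, c, d#})"
proof -
  let ?xss = "[[a], [b], [c], [d], [a+b, a+(b+c)], [a+c, a+(c+d)], [b+d, a+(b+d)],
    [b+(c+d), a+(b+(c+d))]]"
  show ?thesis
  proof (rule serves_listsI[of ?xss])
    show "distinct (concat ?xss)"
      using dist by (simp add: ac_simps) (elim conjE, simp)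
  qed (simp_all add: ac_simps add_mset_commute)
qed

end

text \<open>Needed when all four basis vectors have odd multiplicity. Reordering the basis reduces
  it to \<open>e = f = a\<close>, or to \<open>e = a\<close> and \<open>f = b\<close>.\<close>

lemma serves_16_eeff:
  assumes dist: "distinct (subset_sums [a, b, c, d :: 'a::boolean_group])"
    and "e \<in> {a, b, c, d}" "f \<in> {a, b, c, d}"
  shows "serves (set (subset_sums [a, b, c, d])) ({#a, b, c, d#} + {#e, e, f, f#})"
proof -
  obtain x y z where perm: "mset [a, b, c, d] = mset [e, x, y, z]"
    using obtain_perm_4[OF assms(2)] .
  have f: "f = e \<or> f \<in> {x, y, z}" using assms(3) mset_eq_setD[OF perm] by auto
  show ?thesis
  proof (cases "f = e")
    case True
    have "distinct (subset_sums [e, x, y, z])"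
      using dist distinct_subset_sums_perm[OF perm] by blast
    from serves_16_aaaa[OF this] True perm show ?thesis
      unfolding set_subset_sums_perm[OF perm] by simp
  next
    case False
    then obtain u w where "mset [x, y, z] = mset [f, u, w]"
    proof -
      have "mset [x, y, z] = mset [y, x, z]" "mset [x, y, z] = mset [z, x, y]"
        by (simp_all add: ac_simps)
      with f False that show thesis by blast
    qed
    then have perm2: "mset [a, b, c, d] = mset [e, f, u, w]" using perm by simp
    have "distinct (subset_sums [e, f, u, w])"
      using dist distinct_subset_sums_perm[OF perm2] by blast
    from serves_16_aabb[OF this] perm2 show ?thesis
      unfolding set_subset_sums_perm[OF perm2] by simp
  qed
qed

text \<open>Needed when only \<open>a\<close> and \<open>b\<close> have odd multiplicity:
  \<open>c\<close> and \<open>d\<close> occur twice, and one further pair \<open>e, e\<close> fills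
  the quota of eight. Swapping \<open>a, b\<close> or \<open>c, d\<close> leaves two cases.\<close>

lemma serves_16_cdee:
  assumes dist: "distinct (subset_sums [a, b, c, d :: 'a::boolean_group])"
    and e: "e \<in> {a, b, c, d}"
  shows "serves (set (subset_sums [a, b, c, d])) ({#a, b, c, d#} + {#c, d, e, e#})"
proof -
  have perms: "mset [a, b, c, d] = mset [a, b, d, c]" "mset [a, b, c, d] = mset [b, a, c, d]"
    by (simp_all add: ac_simps)
  note dists = dist[unfolded distinct_subset_sums_perm[OF perms(1)]]
    dist[unfolded distinct_subset_sums_perm[OF perms(2)]]
  consider "e = a" | "e = b" | "e = c" | "e = d" using e by blast
  then show ?thesis
  proof cases
    case 1
    then show ?thesis using serves_16_aacd[OF dist] by (simp add: add_mset_commute del: subset_sums.simps)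
  next
    case 2
    then show ?thesis using serves_16_aacd[OF dists(2)] unfolding set_subset_sums_perm[OF perms(2)]
      by (simp add: add_mset_commute del: subset_sums.simps)
  next
    case 3
    then show ?thesis using serves_16_cccd[OF dist] by (simp add: add_mset_commute del: subset_sums.simps)
  next
    case 4
    then show ?thesis using serves_16_cccd[OF dists(1)] unfolding set_subset_sums_perm[OF perms(1)]
      by (simp add: add_mset_commute del: subset_sums.simps)
  qed
qed


section \<open>Cases by the number of odd multiplicities\<close>

lemma serves_evenly:
  assumes "evenly_served U G" "additively_closed V" "finite V" "U \<subseteq> V"
    and "card V = 4 * size N" "set_mset N \<subseteq> G"
  shows "serves V (N + N)"
proof -
  have "stable_under U V" using assms by (auto intro: stable_under_subset stable_under_self)
  with assms show ?thesis unfolding evenly_served_def by blast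
qed

lemma distinct_subset_sums_2:
  "p \<noteq> 0 \<Longrightarrow> q \<noteq> 0 \<Longrightarrow> p \<noteq> q \<Longrightarrow> distinct (subset_sums [p, q :: 'a::boolean_group])"
  by (auto simp: add_eq_0_iff_eq)

text \<open>Spans of dimension 2, 3, 4 are built from requested vectors until they contain all of
  them; the span reached pairs up \<open>V\<close>.\<close>

lemma serves_group_even:
  fixes V :: "'a::boolean_group set"
  assumes V: "finite V" "additively_closed V" "card V = 4 * size N"
    and N: "set_mset N \<subseteq> V - {0}" "card (set_mset N) \<le> 4"
    and pq: "p \<in># N" "q \<in># N" "p \<noteq> q"
  shows "serves V (N + N)"
proof -
  let ?F = "set (subset_sums [p, q])"
  have dF: "distinct (subset_sums [p, q])" using pq N by (intro distinct_subset_sums_2) auto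
  have cF: "card ?F = 4" by (simp add: card_subset_sums[OF dF] del: subset_sums.simps)
  have FV: "?F \<subseteq> V" using pq N V by (intro subset_sums_subset) auto
  show ?thesis
  proof (cases "set_mset N \<subseteq> ?F")
    case True
    show ?thesis
      by (rule serves_evenly[OF evenly_served_4[OF additively_closed_subset_sums cF] V(2,1) FV])
        (use V N True in auto)
  next
    case False
    then obtain r where r: "r \<in># N" "r \<notin> ?F" by blast
    let ?U = "set (subset_sums [r, p, q])"
    have dU: "distinct (subset_sums [r, p, q])" using dF r(2) by (rule distinct_subset_sums_Cons)
    have UV: "?U \<subseteq> V" using pq N V r by (intro subset_sums_subset) auto
    show ?thesis
    proof (cases "set_mset N \<subseteq> ?U")
      case True
      have "evenly_served ?U (?U - {0})"
        by (rule evenly_served_8[OF additively_closed_subset_sums])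
          (simp add: card_subset_sums[OF dU] del: subset_sums.simps)
      then show ?thesis
        by (rule serves_evenly) (use V N UV True in auto)
    next
      case False
      then obtain d where d: "d \<in># N" "d \<notin> ?U" by blast
      have dW: "distinct (subset_sums [d, r, p, q])" using dU d(2) by (rule distinct_subset_sums_Cons)
      have WV: "set (subset_sums [d, r, p, q]) \<subseteq> V" using pq N V r d by (intro subset_sums_subset) auto
      \<comment> \<open>With at most four distinct requests, the basis exhausts them, as the
        restricted set of differences in \<open>evenly_served_16\<close> demands.\<close>
      have "card {d, r, p, q} = 4" using dW by auto
      then have "{d, r, p, q} = set_mset N"
        using N pq r d by (intro card_seteq) auto
      with V show ?thesis
        by (intro serves_evenly[OF evenly_served_16[OF dW] _ _ WV]) auto
    qed
  qed
qed

text \<open>The spans grow from that of \<open>p, q\<close> as in the even case, but the span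
  reached must itself absorb \<open>p\<close> and \<open>q\<close>, along with enough doubled
  vectors to total half its order.\<close>

lemma serves_group_two_odd:
  fixes V :: "'a::boolean_group set"
  assumes V: "finite V" "additively_closed V" "card V = 4 + 4 * size N"
    and M: "insert p (insert q (set_mset N)) \<subseteq> V - {0}" "card (insert p (insert q (set_mset N))) \<le> 4"
    and pq: "p \<noteq> q"
  shows "serves V ({#p, q#} + (N + N))"
proof -
  let ?F = "set (subset_sums [p, q])"
  have dF: "distinct (subset_sums [p, q])" using pq M by (intro distinct_subset_sums_2) auto
  have cF: "card ?F = 4" by (simp add: card_subset_sums[OF dF] del: subset_sums.simps)
  have FV: "?F \<subseteq> V" using pq M V by (intro subset_sums_subset) auto
  show ?thesis
  proof (cases "set_mset N \<subseteq> ?F")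
    case True
    have "serves ?F {#p, q#}"
      by (rule serves_listsI[of "[[p], [q]]"]) (use pq in auto)
    then show ?thesis
      by (rule serves_extend[OF evenly_served_4[OF additively_closed_subset_sums cF]
          additively_closed_subset_sums V(2,1) FV])
        (use cF V M True in auto)
  next
    case False
    then obtain r where r: "r \<in># N" "r \<notin> ?F" by blast
    then obtain N' where N': "N = add_mset r N'" by (metis insert_DiffM)
    let ?U = "set (subset_sums [r, p, q])"
    have dU: "distinct (subset_sums [r, p, q])" using dF r(2) by (rule distinct_subset_sums_Cons)
    have UV: "?U \<subseteq> V" using M V r by (intro subset_sums_subset) auto
    have cU: "card ?U = 8" by (simp add: card_subset_sums[OF dU] del: subset_sums.simps)
    show ?thesis
    proof (cases "set_mset N' \<subseteq> ?U")
      case True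
      \<comment> \<open>One copy of \<open>r\<close> is the single column, the other the pair
        \<open>{p + q, r + (p + q)}\<close>.\<close>
      have s: "serves ?U {#p, q, r, r#}"
      proof (rule serves_listsI[of "[[p], [q], [r], [p + q, r + (p + q)]]"])
        show "distinct (concat [[p], [q], [r], [p + q, r + (p + q)]])"
          using dU by (simp add: ac_simps) (elim conjE, simp)
      qed (simp_all add: ac_simps add_mset_commute)
      have "serves V ({#p, q, r, r#} + (N' + N'))"
        by (rule serves_extend[OF evenly_served_8[OF additively_closed_subset_sums cU]
          additively_closed_subset_sums V(2,1) UV s])
          (use cU V M True N' in auto)
      then show ?thesis by (simp add: N' add_mset_commute)
    next
      case False
      then obtain d where d: "d \<in># N'" "d \<notin> ?U" by blast
      then obtain N'' where N'': "N' = add_mset d N''" by (metis insert_DiffM)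
      let ?W = "set (subset_sums [d, r, p, q])"
      have dW: "distinct (subset_sums [d, r, p, q])" using dU d(2) by (rule distinct_subset_sums_Cons)
      have WV: "?W \<subseteq> V" using M N' V d by (intro subset_sums_subset) auto
      have cW: "card ?W = 16" by (simp add: card_subset_sums[OF dW] del: subset_sums.simps)
      then have "16 \<le> card V" using card_mono[OF V(1) WV] by simp
      \<comment> \<open>Order at least 16 forces \<open>size N \<ge> 3\<close>, so a doubled vector
        \<open>e\<close> remains beyond \<open>r\<close> and \<open>d\<close>.\<close>
      then have "size N'' \<noteq> 0" using V N' N'' by auto
      then obtain e N3 where e: "N'' = add_mset e N3" by (metis multiset_cases size_empty)
      have "card {d, r, p, q} = 4" using dW by auto
      then have Meq: "{d, r, p, q} = insert p (insert q (set_mset N))"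
        using M N' d by (intro card_seteq) auto
      have perm: "mset [p, q, r, d] = mset [d, r, p, q]" by (simp add: add_mset_commute)
      have "serves ?W ({#p, q, r, d#} + {#r, d, e, e#})"
        unfolding set_subset_sums_perm[OF perm, symmetric]
        by (rule serves_16_cdee)
          (use dW distinct_subset_sums_perm[OF perm] Meq e N' N'' in auto)
      then have "serves V (({#p, q, r, d#} + {#r, d, e, e#}) + (N3 + N3))"
        by (rule serves_extend[OF evenly_served_16[OF dW]
          additively_closed_subset_sums V(2,1) WV])
          (use cW V Meq N' N'' e in auto)
      then show ?thesis by (simp add: N' N'' e add_mset_commute)
    qed
  qed
qed

text \<open>Three of the four vectors can be chosen independent. If the fourth lies in their span of
  order 8, four single columns suffice there; otherwise the span of order 16 also takes two doubled
  vectors.\<close>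

lemma serves_group_four_odd:
  fixes V :: "'a::boolean_group set"
  assumes V: "finite V" "additively_closed V" "card V = 8 + 4 * size N"
    and P: "P \<subseteq> V - {0}" "card P = 4" "set_mset N \<subseteq> P"
  shows "serves V (mset_set P + (N + N))"
proof -
  have "finite P" using P by (intro card_ge_0_finite) simp
  then obtain xs where xs: "set xs = P" "distinct xs" using finite_distinct_list by blast
  then have "length xs = 4" using P distinct_card by fastforce
  then obtain p q r' d' where xs': "xs = [p, q, r', d']"
    by (auto simp: numeral_eq_Suc length_Suc_conv)
  \<comment> \<open>at most one of the other two elements equals \<open>p + q\<close>\<close>
  obtain r d where rd: "P = {p, q, r, d}" "distinct [p, q, r, d]" "r \<noteq> p + q"
  proof (cases "r' = p + q")
    case True
    with that[of d' r'] xs xs' show thesis by auto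
  next
    case False
    with that[of r' d'] xs xs' show thesis by auto
  qed
  have nz: "p \<noteq> 0" "q \<noteq> 0" "r \<noteq> 0" "d \<noteq> 0" using rd P by auto
  have mP: "mset_set P = {#p, q, r, d#}" using rd by simp
  have "r \<notin> set (subset_sums [p, q])" using rd nz by auto
  moreover have "distinct (subset_sums [p, q])" using nz rd by (intro distinct_subset_sums_2) auto
  ultimately have dU: "distinct (subset_sums [r, p, q])" by (metis distinct_subset_sums_Cons)
  let ?U = "set (subset_sums [r, p, q])"
  have cU: "card ?U = 8" by (simp add: card_subset_sums[OF dU] del: subset_sums.simps)
  have UV: "?U \<subseteq> V" using P V rd by (intro subset_sums_subset) auto
  show ?thesis
  proof (cases "d \<in> ?U")
    case True
    then have PU: "P \<subseteq> ?U - {0}" using rd nz by auto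
    have "serves ?U (mset_set P)"
      by (rule serves_listsI[of "[[p], [q], [r], [d]]"]) (use PU rd mP in auto)
    then show ?thesis
      by (rule serves_extend[OF evenly_served_8[OF additively_closed_subset_sums cU]
          additively_closed_subset_sums V(2,1) UV])
        (use V P PU cU in auto)
  next
    case False
    let ?W = "set (subset_sums [d, r, p, q])"
    have dW: "distinct (subset_sums [d, r, p, q])" using dU False by (rule distinct_subset_sums_Cons)
    have WV: "?W \<subseteq> V" using P rd V by (intro subset_sums_subset) auto
    have cW: "card ?W = 16" by (simp add: card_subset_sums[OF dW] del: subset_sums.simps)
    then have "16 \<le> card V" using card_mono[OF V(1) WV] by simp
    then have "2 \<le> size N" using V by auto
    then obtain A N' where A: "N = A + N'" "size A = 2" by (rule multiset_split_size)
    then obtain e f where ef: "A = {#e, f#}"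
      by (metis One_nat_def Suc_1 size_1_singleton_mset size_add_mset size_eq_Suc_imp_eq_union nat.inject)
    have "serves ?W ({#d, r, p, q#} + {#e, e, f, f#})"
      by (rule serves_16_eeff[OF dW]) (use rd A ef P in auto)
    then have "serves V (({#d, r, p, q#} + {#e, e, f, f#}) + (N' + N'))"
      by (rule serves_extend[OF evenly_served_16[OF dW]
          additively_closed_subset_sums V(2,1) WV])
        (use cW V A ef P rd in auto)
    then show ?thesis by (simp add: mP A ef add_mset_commute)
  qed
qed

lemma serves_group:
  fixes V :: "'a::boolean_group set"
  assumes V: "finite V" "additively_closed V" "card V = 2 ^ n"
    and M: "set_mset M \<subseteq> V - {0}" "2 * size M = 2 ^ n" "card (set_mset M) \<le> 4"
  shows "serves V M"
proof (cases "\<exists>v. set_mset M \<subseteq> {v}")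
  case True
  then obtain v where v: "set_mset M \<subseteq> {v}" by blast
  then have M_eq: "M = replicate_mset (size M) v" by (metis set_mset_subset_singletonD)
  \<comment> \<open>Its size is half of \<open>2 ^ n\<close>, hence positive; this places
    \<open>v\<close> among the requests and so in \<open>V - {0}\<close>.\<close>
  have "M \<noteq> {#}" using M by auto
  then have "v \<in># M" using v by (metis set_mset_eq_empty_iff subset_singleton_iff singletonI)
  then have "v \<in> V - {0}" using M by blast
  then have "serves V (replicate_mset (size M) v)"
    using V M stable_under_self[OF V(2)]
    by (intro serves_single_vector) (auto intro: stable_under_subset)
  with M_eq show ?thesis by simp
next
  case False
  then obtain p q where pq: "p \<in># M" "q \<in># M" "p \<noteq> q" by blast
  \<comment> \<open>Two distinct requests span a subgroup of order 4, so \<open>n \<ge> 2\<close>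
    and \<open>size M\<close> is even; hence so is the number of odd multiplicities.\<close>
  have "distinct (subset_sums [p, q])" using pq M by (intro distinct_subset_sums_2) auto
  then have "card (set (subset_sums [p, q])) = 2 ^ 2" by (subst card_subset_sums) auto
  moreover have "set (subset_sums [p, q]) \<subseteq> V" using pq M V by (intro subset_sums_subset) auto
  ultimately have "2 ^ 2 \<le> (2::nat) ^ n" using card_mono[OF V(1)] V(3) by metis
  then have "2 \<le> n" by (rule power_le_imp_le_exp[rotated]) simp
  then have "(2::nat) ^ 2 dvd 2 ^ n" by (rule le_imp_power_dvd)
  then have "4 dvd 2 * size M" using M by simp
  then have even: "even (size M)" by presburger
  obtain P N where PN: "M = mset_set P + (N + N)" "finite P" "P \<subseteq> set_mset M"
    using multiset_parity_split[of M] by blast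
  have "even (card P)" using even PN by simp
  moreover have "card P \<le> 4" using card_mono[OF _ PN(3)] M(3) by simp
  ultimately have "card P = 0 \<or> card P = 2 \<or> card P = 4" by presburger
  then show ?thesis
  proof (elim disjE)
    assume "card P = 0"
    then have "P = {}" using PN by simp
    then show ?thesis
      using PN(1) V M pq serves_group_even[of V N p q] by auto
  next
    assume "card P = 2"
    then obtain x y where P: "P = {x, y}" "x \<noteq> y" by (meson card_2_iff)
    then show ?thesis
      using PN(1) V M serves_group_two_odd[of V N x y] by auto
  next
    assume P4: "card P = 4"
    \<comment> \<open>Four odd vectors already exhaust the distinct requests.\<close>
    then have P: "set_mset M = P" using M PN(3) by (intro card_seteq[symmetric]) auto
    have "set_mset N \<subseteq> set_mset M" "size M = 4 + 2 * size N" using PN(1) P4 by auto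
    then have "serves V (mset_set P + (N + N))"
      using V M P4 unfolding P by (intro serves_group_four_odd) auto
    then show ?thesis using PN(1) by simp
  qed
qed

section \<open>Transfer to the simplex code\<close>

lemma sum_fun_apply: "(\<Sum>l\<in>A. g l) k = (\<Sum>l\<in>A. (g l k :: 'b::comm_monoid_add))"
  by (induction A rule: infinite_finite_induct) auto

theorem mainTheorem12:
  fixes n s :: nat and g :: "nat \<Rightarrow> nat \<Rightarrow> bit"
  assumes "1 \<le> n"
    and "simplex_generator n g"
    and "1 \<le> s" and "s \<le> min 4 (2^(n-1))"
  shows "functional_batch_code n (2^n - 1) g s (2^(n-1))"
  unfolding functional_batch_code_def
proof (intro allI impI, elim conjE)
  fix v :: "nat \<Rightarrow> nat \<Rightarrow> bit" and a :: "nat \<Rightarrow> nat"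
  assume v: "\<forall>i<s. v i \<in> F2vec n - {\<lambda>_. 0}" and a: "(\<Sum>i<s. a i) = 2^(n-1)"
  define V where "V = F2vec n"
  have g: "bij_betw g {..<2^n - 1} (V - {0})"
    using assms(2) by (simp add: simplex_generator_def V_def zero_fun_def)
  have "0 \<in> V" by (simp add: V_def F2vec_def)
  have closed: "additively_closed V" by (auto simp: V_def F2vec_def additively_closed_def)
  have "finite (V - {0})" using bij_betw_finite[OF g] by simp
  then have fin: "finite V" by simp
  have "card (V - {0}) = 2^n - 1" using bij_betw_same_card[OF g] by simp
  then have card: "card V = 2^n"
    using \<open>0 \<in> V\<close> fin by (simp add: card_Diff_singleton_if split: if_splits)
      (metis One_nat_def Suc_pred card_gt_0_iff empty_iff zero_less_numeral zero_less_power)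
  \<comment> \<open>\<open>J\<close> indexes the individual requests. In \<open>M\<close>,
    coinciding \<open>v i\<close> pool their multiplicities, so parities refer to distinct
    vectors.\<close>
  define J where "J = Sigma {..<s} (\<lambda>i. {..<a i})"
  define M where "M = image_mset (\<lambda>(i, j). v i) (mset_set J)"
  have finJ: "finite J" by (simp add: J_def)
  have setM: "set_mset M \<subseteq> v ` {..<s}" using finJ by (auto simp: M_def J_def)
  have "serves V M"
  proof (rule serves_group[OF fin closed card])
    show "set_mset M \<subseteq> V - {0}" using setM v by (force simp: V_def zero_fun_def)
    have "size M = 2^(n-1)" by (simp add: M_def J_def a)
    then show "2 * size M = 2^n" using assms(1) by (cases n) auto
    show "card (set_mset M) \<le> 4"
      using card_mono[OF _ setM] card_image_le[of "{..<s}" v] assms(4) by simp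
  qed
  then have "serves (V - {0}) M" by (rule serves_remove_zero)
  from serves_obtains_family[OF this finJ, of "\<lambda>(i, j). v i"]
  obtain R where R: "\<forall>x\<in>J. R x \<subseteq> V - {0} \<and> \<Sum>(R x) = (case x of (i, j) \<Rightarrow> v i)"
    "disjoint_family_on R J"
    by (simp only: M_def) blast
  \<comment> \<open>Pulls the sets of vectors back along the bijection \<open>g\<close> to sets of
    column indices.\<close>
  define S where "S i j = {l \<in> {..<2^n - 1}. g l \<in> R (i, j)}" for i j
  have inj: "inj_on g {..<2^n - 1}" using g by (rule bij_betw_imp_inj_on)
  show "\<exists>R. (\<forall>i<s. \<forall>j<a i. R i j \<subseteq> {..<2^n - 1} \<and> (\<lambda>k. \<Sum>l\<in>R i j. g l k) = v i) \<and>
      (\<forall>i<s. \<forall>j<a i. \<forall>i'<s. \<forall>j'<a i'. (i, j) \<noteq> (i', j') \<longrightarrow> R i j \<inter> R i' j' = {})"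
  proof (intro exI[of _ S] conjI allI impI)
    fix i j assume ij: "i < s" "j < a i"
    then have Rij: "R (i, j) \<subseteq> V - {0}" "\<Sum>(R (i, j)) = v i" using R(1) by (force simp: J_def)+
    have img: "g ` S i j = R (i, j)"
      using Rij(1) bij_betw_imp_surj_on[OF g] by (auto simp: S_def)
    have "inj_on g (S i j)" using inj by (rule inj_on_subset) (auto simp: S_def)
    then have "(\<Sum>l\<in>S i j. g l) = v i"
      using Rij(2) sum.reindex[of g "S i j" "\<lambda>x. x"] by (simp add: img)
    then show "(\<lambda>k. \<Sum>l\<in>S i j. g l k) = v i" by (simp add: fun_eq_iff flip: sum_fun_apply)
    show "S i j \<subseteq> {..<2^n - 1}" by (auto simp: S_def)
  next
    fix i j i' j' assume "i < s" "j < a i" "i' < s" "j' < a i'" "(i, j) \<noteq> (i', j')"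
    then have "R (i, j) \<inter> R (i', j') = {}"
      using R(2) by (intro disjoint_family_onD) (auto simp: J_def)
    then show "S i j \<inter> S i' j' = {}" by (auto simp: S_def)
  qed
qed

end
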